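(* Let $g\colon\mathbf{R}^n\to\mathbf{R}\cup\{\pm\infty\}$ be a closed convex function and let $f\colon\mathbf{R}^n\to\mathbf{R}$ be a convex $C^1$-smooth function with a $\beta$-Lipschitz continuous gradient. Set $\varphi:=f+g$, let $S$ be the set of minimizers of $\varphi$, and let $\varphi^*$ be the minimal value of $\varphi$. Suppose that the error bound condition holds with parameters $(\gamma,\nu)$, where $\gamma,\nu>0$. Then the proximal gradient method with $t\le\beta^{-1}$ satisfies $\varphi(x_k)-\varphi^*\le\epsilon$ after at most $$k\le\frac{\beta}{2\nu}\,\mathrm{dist}^2(x_0,S)+2\beta\gamma\ln\left(\frac{\varphi(x_0)-\varphi^*}{\epsilon}\right)\qquad\text{iterations.}$$ Moreover, if the iterates $x_k$ have some limit point $x^*$, then there exists an index $r$ such that the inequality $$\|x_{r+k}-x^*\|^2\le\left(1-\frac{1}{2\beta\gamma}\right)^{k}C\cdot(\varphi(x_r)-\varphi^* )$$ holds for all $k\ge1$, where $$C:=\frac{2}{\beta\left(1-\sqrt{1-(2\beta\gamma)^{-1}}\right)^2}.$$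
   Context: For a real $t>0$, $\mathrm{prox}_{tg}(x):=\operatorname{argmin}_{y}\{g(y)+\frac{1}{2t}\|y-x\|^2\}$, and the prox-gradient mapping is $\mathcal{G}_t(x):=t^{-1}\big(x-\mathrm{prox}_{tg}(x-t\nabla f(x))\big)$. The proximal gradient method with step size $t>0$, started at $x_0$, is the recurrence $x_{k+1}=\mathrm{prox}_{tg}(x_k-t\nabla f(x_k))=x_k-t\,\mathcal{G}_t(x_k)$. The distance to a set is $\mathrm{dist}(x,S):=\inf_{z\in S}\|z-x\|$. Given real numbers $\gamma,\nu>0$, the error bound condition holds with parameters $(\gamma,\nu)$ if $\mathrm{dist}(x,S)\le\gamma\|\mathcal{G}_t(x)\|$ for all $x$ satisfying $\varphi(x)\le\varphi^*+\nu$.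
   Formalization: In the iteration bound, the linear rate and the constant C, β is replaced by 1/t; the formulas agree with those above when t = 1/β, and as written they fail for t much smaller than 1/β (e.g. f(x) = x²/2, g = 0, β = 1, t = 1/100). *)

theory Defs
  imports "HOL-Analysis.Analysis"
begin

definition epi :: "('a \<Rightarrow> ereal) \<Rightarrow> ('a \<times> real) set"
  where "epi g = {(y, r). g y \<le> ereal r}"

definition closed_convex_fun :: "('a::euclidean_space \<Rightarrow> ereal) \<Rightarrow> bool"
  where "closed_convex_fun g \<longleftrightarrow> closed (epi g) \<and> convex (epi g)"

definition minimizers :: "('a \<Rightarrow> ereal) \<Rightarrow> 'a set"
  where "minimizers \<phi> = {z. \<forall>y. \<phi> z \<le> \<phi> y}"

(* The minimal value is attained and real.  For \<phi> = f + g with f real-valued this makes g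
   proper (nowhere -\<infinity>, somewhere finite), so no separate properness hypothesis is needed. *)
definition is_minimal_value :: "('a \<Rightarrow> ereal) \<Rightarrow> real \<Rightarrow> bool"
  where "is_minimal_value \<phi> m \<longleftrightarrow> (\<forall>y. ereal m \<le> \<phi> y) \<and> (\<exists>z. \<phi> z = ereal m)"

(* For g closed, convex and proper and t > 0 the minimizer exists and is unique, so the
   choice made by arg_min is immaterial. *)
definition prox :: "real \<Rightarrow> ('a::euclidean_space \<Rightarrow> ereal) \<Rightarrow> 'a \<Rightarrow> 'a"
  where "prox t g x = arg_min (\<lambda>y. g y + ereal (1 / (2 * t) * (norm (y - x))\<^sup>2)) (\<lambda>_. True)"

definition prox_grad_map ::
    "real \<Rightarrow> ('a::euclidean_space \<Rightarrow> ereal) \<Rightarrow> ('a \<Rightarrow> 'a) \<Rightarrow> 'a \<Rightarrow> 'a"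
  where "prox_grad_map t g gradf x = (1 / t) *\<^sub>R (x - prox t g (x - t *\<^sub>R gradf x))"

(* gradf plays the role of the gradient of f; m is the minimal value of f + g.
   Caution: infdist x {} = 0, but the set of minimizers is nonempty wherever this is used. *)
definition error_bound ::
    "real \<Rightarrow> ('a::euclidean_space \<Rightarrow> real) \<Rightarrow> ('a \<Rightarrow> 'a) \<Rightarrow> ('a \<Rightarrow> ereal) \<Rightarrow> real \<Rightarrow> real \<Rightarrow> real \<Rightarrow> bool"
  where "error_bound t f gradf g m \<gamma> \<nu> \<longleftrightarrow>
    (\<forall>x. ereal (f x) + g x \<le> ereal (m + \<nu>) \<longrightarrow>
       infdist x (minimizers (\<lambda>y. ereal (f y) + g y)) \<le> \<gamma> * norm (prox_grad_map t g gradf x))"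

definition prox_grad_iterates ::
    "real \<Rightarrow> ('a::euclidean_space \<Rightarrow> ereal) \<Rightarrow> ('a \<Rightarrow> 'a) \<Rightarrow> (nat \<Rightarrow> 'a) \<Rightarrow> bool"
  where "prox_grad_iterates t g gradf x \<longleftrightarrow>
    (\<forall>k. x (Suc k) = prox t g (x k - t *\<^sub>R gradf (x k)))"

definition seq_limit_point :: "(nat \<Rightarrow> 'a::topological_space) \<Rightarrow> 'a \<Rightarrow> bool"
  where "seq_limit_point x z \<longleftrightarrow> (\<exists>\<rho>. strict_mono \<rho> \<and> (x \<circ> \<rho>) \<longlonglongrightarrow> z)"

(* The next two definitions carry the constants of the rates as functions of a Lipschitz constant
   L of the gradient.  With step size t the rates hold for L = 1/t, which is a Lipschitz constant
   of the gradient whenever t \<le> 1/\<beta> and \<beta> is one.  They fail for L = \<beta> if t is much smaller than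
   1/\<beta>: for g = 0 and f = (\<beta>/2) |x|^2 the error bound holds with \<gamma> = 1/\<beta> and every \<nu>, whatever t,
   but x_k = (1 - t \<beta>)^k x_0. *)
definition iteration_bound :: "real \<Rightarrow> real \<Rightarrow> real \<Rightarrow> real \<Rightarrow> real \<Rightarrow> real \<Rightarrow> real"
  where "iteration_bound L \<gamma> \<nu> d \<delta> \<epsilon> = L / (2 * \<nu>) * d\<^sup>2 + 2 * L * \<gamma> * ln (\<delta> / \<epsilon>)"

definition limit_constant :: "real \<Rightarrow> real \<Rightarrow> real"
  where "limit_constant L \<gamma> = 2 / (L * (1 - sqrt (1 - 1 / (2 * L * \<gamma>)))\<^sup>2)"

end

theory Submission
  imports Defs
begin

text \<open>Strong convexity of the prox subproblem, the descent lemma and convexity of \<^term>\<open>f\<close> give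
  for a step from $x$ to $x^+$ and every $y$ the inequality
  $\varphi(x^+) + \frac L2 \|x^+ - y\|^2 \le \varphi(y) + \frac L2 \|x - y\|^2$, where $L = 1/t$.
  With $y$ a minimizer it sums to a budget for the gaps $\varphi(x_k) - \varphi^*$, which bounds the
  number of steps before the gap drops below $\nu$; with $y = x$ it bounds the step length by the
  decrease of the gap. From then on the error bound turns these two into linear decrease of the
  gap, hence into geometrically decaying step lengths.\<close>


section \<open>Smooth convex functions: tangent planes and the descent lemma\<close>

lemma GDERIV_line:
  assumes "GDERIV f (x + s *\<^sub>R d) :> D"
  shows "((\<lambda>s. f (x + s *\<^sub>R d)) has_real_derivative D \<bullet> d) (at s)"
proof -
  have "((\<lambda>s. x + s *\<^sub>R d) has_derivative (\<lambda>s. s *\<^sub>R d)) (at s)"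
    by (auto intro!: derivative_eq_intros)
  from has_derivative_compose[OF this assms[unfolded gderiv_def]]
  show ?thesis
    by (rule has_derivative_imp_has_field_derivative) (simp add: inner_commute)
qed

lemma convex_above_tangent_plane:
  fixes f :: "'a::real_inner \<Rightarrow> real"
  assumes "convex_on UNIV f" and "GDERIV f x :> D"
  shows "f x + D \<bullet> (y - x) \<le> f y"
proof -
  let ?h = "\<lambda>s. f (x + s *\<^sub>R (y - x))"
  have "convex_on UNIV ?h"
  proof (rule convex_onI)
    fix u a b :: real
    assume "0 < u" "u < 1"
    moreover have "x + ((1 - u) *\<^sub>R a + u *\<^sub>R b) *\<^sub>R (y - x)
        = (1 - u) *\<^sub>R (x + a *\<^sub>R (y - x)) + u *\<^sub>R (x + b *\<^sub>R (y - x))"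
      by (simp add: algebra_simps)
    ultimately show "?h ((1 - u) *\<^sub>R a + u *\<^sub>R b) \<le> (1 - u) * ?h a + u * ?h b"
      using convex_onD[OF assms(1), of u "x + a *\<^sub>R (y - x)" "x + b *\<^sub>R (y - x)"] by simp
  qed simp
  moreover have "(?h has_real_derivative D \<bullet> (y - x)) (at 0 within UNIV)"
    using GDERIV_line[of f x 0 "y - x" D] assms(2) by simp
  ultimately have "?h 1 - ?h 0 \<ge> D \<bullet> (y - x) * (1 - 0)"
    by (intro convex_on_imp_above_tangent) auto
  then show ?thesis by simp
qed

text \<open>Subtracting the linear and quadratic terms from \<open>f\<close> along the segment from
  \<open>x\<close> to \<open>y\<close> leaves a function with nonpositive derivative, by
  Cauchy-Schwarz and the Lipschitz bound; its monotonicity replaces integration of the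
  gradient.\<close>

lemma descent_lemma:
  fixes f :: "'a::real_inner \<Rightarrow> real"
  assumes grad: "\<And>y. GDERIV f y :> F y" and lip: "L-lipschitz_on UNIV F"
  shows "f y \<le> f x + F x \<bullet> (y - x) + L / 2 * (norm (y - x))\<^sup>2"
proof -
  let ?d = "y - x"
  let ?h = "\<lambda>s. f (x + s *\<^sub>R ?d) - s * (F x \<bullet> ?d) - L / 2 * s\<^sup>2 * (norm ?d)\<^sup>2"
  have "?h 1 \<le> ?h 0"
  proof (rule DERIV_nonpos_imp_nonincreasing[of 0 1 ?h])
    fix s :: real
    assume s: "0 \<le> s" "s \<le> 1"
    have "((\<lambda>s. f (x + s *\<^sub>R ?d)) has_real_derivative F (x + s *\<^sub>R ?d) \<bullet> ?d) (at s)"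
      by (rule GDERIV_line[OF grad])
    then have "(?h has_real_derivative
        F (x + s *\<^sub>R ?d) \<bullet> ?d - F x \<bullet> ?d - L * s * (norm ?d)\<^sup>2) (at s)"
      by (auto intro!: derivative_eq_intros)
    moreover have "F (x + s *\<^sub>R ?d) \<bullet> ?d - F x \<bullet> ?d \<le> L * s * (norm ?d)\<^sup>2"
    proof -
      have "(F (x + s *\<^sub>R ?d) - F x) \<bullet> ?d \<le> norm (F (x + s *\<^sub>R ?d) - F x) * norm ?d"
        by (rule norm_cauchy_schwarz)
      also have "\<dots> \<le> (L * (s * norm ?d)) * norm ?d"
        using lipschitz_onD[OF lip, of "x + s *\<^sub>R ?d" x] s
        by (intro mult_right_mono) (auto simp: dist_norm)
      finally show ?thesis
        by (simp add: inner_diff_left power2_eq_square algebra_simps)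
    qed
    ultimately show "\<exists>D. (?h has_real_derivative D) (at s) \<and> D \<le> 0"
      by fastforce
  qed simp
  then show ?thesis by simp
qed

section \<open>The prox subproblem: existence of a minimizer and quadratic growth\<close>

lemma closed_convex_fun_convexD:
  assumes "closed_convex_fun g" "g y \<le> ereal a" "g z \<le> ereal b" "0 \<le> u" "u \<le> 1"
  shows "g ((1 - u) *\<^sub>R y + u *\<^sub>R z) \<le> ereal ((1 - u) * a + u * b)"
  using convexD_alt[of "epi g" "(y, a)" "(z, b)" u] assms
  by (simp add: closed_convex_fun_def epi_def)

lemma closed_convex_fun_closedD:
  assumes "closed_convex_fun g" "\<And>n. g (y n) \<le> ereal (a n)" "y \<longlonglongrightarrow> z" "a \<longlonglongrightarrow> b"
  shows "g z \<le> ereal b"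
  using closed_sequentially[of "epi g" "\<lambda>n. (y n, a n)" "(z, b)"] assms
  by (simp add: closed_convex_fun_def epi_def tendsto_Pair)

text \<open>The last term expresses the strong convexity of the squared norm, with equality; it
  drives both the Cauchy estimate and the quadratic growth below.\<close>

lemma norm_convex_combination_diff:
  fixes y z v :: "'a::real_inner"
  shows "(norm ((1 - u) *\<^sub>R y + u *\<^sub>R z - v))\<^sup>2
    = (1 - u) * (norm (y - v))\<^sup>2 + u * (norm (z - v))\<^sup>2 - u * (1 - u) * (norm (y - z))\<^sup>2"
  unfolding power2_norm_eq_inner
  by (simp add: inner_diff_left inner_diff_right inner_add_left inner_add_right
      inner_commute algebra_simps power2_eq_square)

text \<open>No coercivity is needed: strong convexity makes minimizing sequences Cauchy.\<close>
lemma ex_minimizer_plus_quadratic: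
  assumes g: "closed_convex_fun g" and L: "L > 0" and g0: "g y0 \<le> ereal a0"
    and lower: "\<And>y a. g y \<le> ereal a \<Longrightarrow> m \<le> a + L / 2 * (norm (y - v))\<^sup>2"
  obtains p r where "g p \<le> ereal r"
    and "\<And>y a. g y \<le> ereal a \<Longrightarrow> r + L / 2 * (norm (p - v))\<^sup>2 \<le> a + L / 2 * (norm (y - v))\<^sup>2"
proof -
  \<comment> \<open>Minimizing over the epigraph keeps the objective real-valued, although
    \<open>g\<close> may be infinite.\<close>
  define h where "h = (\<lambda>(y, a). a + L / 2 * (norm (y - v))\<^sup>2)"
  define I where "I = Inf (h ` epi g)"
  have bdd: "bdd_below (h ` epi g)"
    using lower by (auto simp: h_def epi_def intro!: bdd_belowI[of _ m])
  have I_le: "I \<le> h w" if "w \<in> epi g" for w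
    unfolding I_def using that bdd by (intro cInf_lower) auto
  have ne: "h ` epi g \<noteq> {}" using g0 by (auto simp: epi_def)
  have "\<exists>w\<in>epi g. h w < I + 1 / (real n + 1)" for n
    using cInf_lessD[OF ne, of "I + 1 / (real n + 1)"] by (auto simp: I_def)
  then obtain w where w: "\<And>n. w n \<in> epi g" "\<And>n. h (w n) < I + 1 / (real n + 1)" by metis
  define y where "y n = fst (w n)" for n
  define a where "a n = snd (w n)" for n
  have ga: "g (y n) \<le> ereal (a n)" for n
    using w(1)[of n] by (auto simp: epi_def y_def a_def split: prod.splits)
  have h_less: "a n + L / 2 * (norm (y n - v))\<^sup>2 < I + 1 / (real n + 1)" for n
    using w(2)[of n] by (simp add: h_def y_def a_def split: prod.splits)
  \<comment> \<open>The midpoint of two almost minimal points cannot go below \<open>I\<close>;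
    strong convexity turns this into a bound on their distance.\<close>
  have close: "L / 4 * (norm (y i - y j))\<^sup>2 \<le> 1 / (real i + 1) + 1 / (real j + 1)" for i j
  proof -
    have "I \<le> h ((1 - 1/2) *\<^sub>R y i + (1/2) *\<^sub>R y j, (1 - 1/2) * a i + 1/2 * a j)"
      using closed_convex_fun_convexD[OF g ga ga, of "1/2" i j]
      by (intro I_le) (simp add: epi_def)
    then show ?thesis
      using h_less[of i] h_less[of j]
      unfolding h_def prod.case norm_convex_combination_diff by (simp add: algebra_simps)
  qed
  have "Cauchy y"
  proof (rule metric_CauchyI)
    fix e :: real assume e: "e > 0"
    obtain N where N: "1 / (real N + 1) < L * e\<^sup>2 / 8"
      using reals_Archimedean[of "L * e\<^sup>2 / 8"] L e by (auto simp: inverse_eq_divide add.commute)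
    have "dist (y i) (y j) < e" if "i \<ge> N" "j \<ge> N" for i j
    proof -
      have "1 / (real i + 1) \<le> 1 / (real N + 1)" "1 / (real j + 1) \<le> 1 / (real N + 1)"
        using that by (auto intro!: divide_left_mono)
      with close[of i j] N have "L / 4 * (norm (y i - y j))\<^sup>2 < L / 4 * e\<^sup>2"
        by (simp add: algebra_simps)
      then have "(norm (y i - y j))\<^sup>2 < e\<^sup>2" using L by simp
      then show ?thesis using e by (simp add: dist_norm power2_less_imp_less)
    qed
    then show "\<exists>M. \<forall>m\<ge>M. \<forall>n\<ge>M. dist (y m) (y n) < e" by blast
  qed
  then obtain p where p: "y \<longlonglongrightarrow> p"
    using Cauchy_convergent_iff convergent_def by blast
  \<comment> \<open>Convergence of the heights \<open>a n\<close> is not established, so larger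
    heights with an explicit limit replace them before closedness is applied.\<close>
  have "(\<lambda>n. I + inverse (real (Suc n)) - L / 2 * (norm (y n - v))\<^sup>2)
      \<longlonglongrightarrow> I + 0 - L / 2 * (norm (p - v))\<^sup>2"
    by (intro tendsto_intros p LIMSEQ_inverse_real_of_nat)
  moreover have "g (y n) \<le> ereal (I + inverse (real (Suc n)) - L / 2 * (norm (y n - v))\<^sup>2)" for n
  proof -
    have "a n \<le> I + inverse (real (Suc n)) - L / 2 * (norm (y n - v))\<^sup>2"
      using h_less[of n] by (simp add: inverse_eq_divide add.commute)
    then show ?thesis using ga[of n] by (meson ereal_less_eq(3) order_trans)
  qed
  ultimately have "g p \<le> ereal (I + 0 - L / 2 * (norm (p - v))\<^sup>2)"
    by (intro closed_convex_fun_closedD[OF g _ p])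
  then show ?thesis
  proof (rule that)
    fix z b assume "g z \<le> ereal b"
    then show "I + 0 - L / 2 * (norm (p - v))\<^sup>2 + L / 2 * (norm (p - v))\<^sup>2
        \<le> b + L / 2 * (norm (z - v))\<^sup>2"
      using I_le[of "(z, b)"] by (simp add: epi_def h_def)
  qed
qed

text \<open>Comparing \<open>p\<close> with \<open>(1 - u) p + u y\<close> and dividing by
  \<open>u\<close> gives the estimate with the growth term damped by \<open>1 - u\<close>; letting
  \<open>u\<close> tend to 0 from the right removes the factor.\<close>

lemma minimizer_plus_quadratic_gap:
  assumes g: "closed_convex_fun g" and L: "L > 0" and gp: "g p \<le> ereal r"
    and min: "\<And>y a. g y \<le> ereal a \<Longrightarrow> r + L / 2 * (norm (p - v))\<^sup>2 \<le> a + L / 2 * (norm (y - v))\<^sup>2"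
    and gy: "g y \<le> ereal a"
  shows "r + L / 2 * (norm (p - v))\<^sup>2 + L / 2 * (norm (p - y))\<^sup>2 \<le> a + L / 2 * (norm (y - v))\<^sup>2"
proof -
  let ?R = "a + L / 2 * (norm (y - v))\<^sup>2 - (r + L / 2 * (norm (p - v))\<^sup>2)"
  have "(1 - u) * (L / 2 * (norm (p - y))\<^sup>2) \<le> ?R" if u: "0 < u" "u < 1" for u
  proof -
    have "u * ((1 - u) * (L / 2 * (norm (p - y))\<^sup>2)) \<le> u * ?R"
      using min[OF closed_convex_fun_convexD[OF g gp gy, of u]] u
      unfolding norm_convex_combination_diff by (simp add: field_simps)
    then show ?thesis using u by simp
  qed
  then have "eventually (\<lambda>u. (1 - u) * (L / 2 * (norm (p - y))\<^sup>2) \<le> ?R) (at_right 0)"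
    unfolding eventually_at_right_field by (intro exI[of _ 1]) auto
  moreover have "((\<lambda>u. (1 - u) * (L / 2 * (norm (p - y))\<^sup>2)) \<longlongrightarrow> (1 - 0) * (L / 2 * (norm (p - y))\<^sup>2))
      (at_right 0)"
    by (intro tendsto_intros)
  ultimately have "(1 - 0) * (L / 2 * (norm (p - y))\<^sup>2) \<le> ?R"
    using tendsto_upperbound trivial_limit_at_right_real by blast
  then show ?thesis by simp
qed

text \<open>Bridges the choice made by \<open>arg_min\<close> and the epigraph argument: existence
  of one minimizer makes \<open>prox t g v\<close> a minimizer, and \<open>lower\<close> keeps the
  value of \<open>g\<close> there off -infinity.\<close>

lemma prox_gap:
  assumes g: "closed_convex_fun g" and t: "t > 0" and g0: "g y0 < \<infinity>"
    and lower: "\<And>y a. g y \<le> ereal a \<Longrightarrow> m \<le> a + 1 / t / 2 * (norm (y - v))\<^sup>2"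
  obtains r where "g (prox t g v) = ereal r"
    and "\<And>y a. g y \<le> ereal a \<Longrightarrow> r + 1 / t / 2 * (norm (prox t g v - v))\<^sup>2
          + 1 / t / 2 * (norm (prox t g v - y))\<^sup>2 \<le> a + 1 / t / 2 * (norm (y - v))\<^sup>2"
proof -
  let ?p = "prox t g v"
  let ?h = "\<lambda>y. g y + ereal (1 / (2 * t) * (norm (y - v))\<^sup>2)"
  obtain a0 where a0: "g y0 \<le> ereal a0"
    using g0 by (cases "g y0") auto
  obtain q s where q: "g q \<le> ereal s"
    and qmin: "\<And>y a. g y \<le> ereal a \<Longrightarrow>
      s + 1 / t / 2 * (norm (q - v))\<^sup>2 \<le> a + 1 / t / 2 * (norm (y - v))\<^sup>2"
    using ex_minimizer_plus_quadratic[where g = g, OF g _ a0 lower] t by auto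
  have q_min: "?h q \<le> ?h y" for y
  proof (cases "g y")
    case (real a)
    have "?h q \<le> ereal s + ereal (1 / (2 * t) * (norm (q - v))\<^sup>2)"
      by (rule add_right_mono[OF q])
    also have "\<dots> \<le> ?h y" using qmin[of y a] real by (simp add: mult.commute)
    finally show ?thesis .
  next
    case MInf
    \<comment> \<open>The value -infinity allows any real height; the one that puts the objective 1
      below the minimum is contradictory.\<close>
    have "s + 1 / t / 2 * (norm (q - v))\<^sup>2 \<le>
      (s + 1 / t / 2 * (norm (q - v))\<^sup>2 - 1 / t / 2 * (norm (y - v))\<^sup>2 - 1)
       + 1 / t / 2 * (norm (y - v))\<^sup>2"
      by (rule qmin) (simp add: MInf)
    then show ?thesis by simp
  qed simp
  have p_min: "?h ?p \<le> ?h y" for y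
    unfolding prox_def using q_min
    by (intro arg_minI[where f = ?h and x = q and Q = "\<lambda>p. ?h p \<le> ?h y"]) (simp_all only: not_less)
  have "?h ?p < \<infinity>" using p_min[of q] q by (cases "g q") auto
  moreover have "g ?p \<noteq> -\<infinity>"
  proof
    assume "g ?p = -\<infinity>"
    then have "m \<le> (m - 1 - 1 / t / 2 * (norm (?p - v))\<^sup>2) + 1 / t / 2 * (norm (?p - v))\<^sup>2"
      by (intro lower) simp
    then show False by simp
  qed
  ultimately obtain r where r: "g ?p = ereal r" by (cases "g ?p") auto
  show ?thesis
  proof (rule that[OF r])
    fix y a assume gy: "g y \<le> ereal a"
    show "r + 1 / t / 2 * (norm (?p - v))\<^sup>2 + 1 / t / 2 * (norm (?p - y))\<^sup>2
        \<le> a + 1 / t / 2 * (norm (y - v))\<^sup>2"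
    proof (rule minimizer_plus_quadratic_gap[OF g _ _ _ gy])
      fix z b assume "g z \<le> ereal b"
      then have "?h ?p \<le> ereal b + ereal (1 / (2 * t) * (norm (z - v))\<^sup>2)"
        using p_min[of z] add_right_mono order_trans by blast
      then show "r + 1 / t / 2 * (norm (?p - v))\<^sup>2 \<le> b + 1 / t / 2 * (norm (z - v))\<^sup>2"
        using r by (simp add: mult.commute)
    qed (use t r in auto)
  qed
qed


section \<open>One step of the method\<close>

text \<open>Completing the square turns the prox objective into \<open>g\<close> plus the
  linearization of \<open>f\<close> at \<open>x\<close> plus a quadratic, up to a constant. In the
  gap inequality the linear terms are then absorbed by the descent lemma at \<open>p\<close> and by
  the tangent plane at \<open>y\<close>.\<close>

lemma prox_grad_step:
  fixes f :: "'a::euclidean_space \<Rightarrow> real" and g :: "'a \<Rightarrow> ereal"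
  assumes g: "closed_convex_fun g" and f: "convex_on UNIV f"
    and grad: "\<And>y. GDERIV f y :> gradf y" and lip: "\<beta>-lipschitz_on UNIV gradf"
    and t: "t > 0" "\<beta> \<le> 1 / t"
    and lower: "\<And>y. ereal m \<le> ereal (f y) + g y" and g0: "g y0 < \<infinity>"
    and p: "p = prox t g (x - t *\<^sub>R gradf x)"
  obtains s where "ereal (f p) + g p = ereal s"
    and "\<And>y a. ereal (f y) + g y \<le> ereal a \<Longrightarrow>
      s + 1 / t / 2 * (dist p y)\<^sup>2 \<le> a + 1 / t / 2 * (dist x y)\<^sup>2"
proof -
  let ?v = "x - t *\<^sub>R gradf x" and ?L = "1 / t"
  \<comment> \<open>Relaxing \<beta> to \<open>1 / t\<close> lets the quadratic of the descent lemma
    match that of the prox objective.\<close>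
  have lip': "?L-lipschitz_on UNIV gradf"
    using lip t(2) by (rule lipschitz_on_le)
  have expand: "?L / 2 * (norm (y - ?v))\<^sup>2
      = ?L / 2 * (dist x y)\<^sup>2 + gradf x \<bullet> (y - x) + t / 2 * (norm (gradf x))\<^sup>2" for y
  proof -
    have "norm (y - ?v) = norm ((y - x) + t *\<^sub>R gradf x)"
      by (simp add: algebra_simps)
    also have "\<dots>\<^sup>2 = (norm (y - x))\<^sup>2 + 2 * t * (gradf x \<bullet> (y - x)) + t\<^sup>2 * (norm (gradf x))\<^sup>2"
      unfolding power2_norm_eq_inner inner_add_left inner_add_right
      by (simp add: inner_commute power2_eq_square)
    finally show ?thesis
      using t by (simp add: dist_norm norm_minus_commute field_simps power2_eq_square)
  qed
  \<comment> \<open>The linearization plus the quadratic dominates \<open>f\<close>, so the lower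
    bound \<open>m\<close> on the whole sum keeps the prox objective bounded below.\<close>
  have "m - f x + t / 2 * (norm (gradf x))\<^sup>2 \<le> a + ?L / 2 * (norm (y - ?v))\<^sup>2"
    if "g y \<le> ereal a" for y a
  proof -
    have "ereal m \<le> ereal (f y) + ereal a"
      using lower[of y] add_left_mono[OF that, of "ereal (f y)"] by (rule order_trans)
    then have "m \<le> f y + a" by simp
    with descent_lemma[OF grad lip', of y x] show ?thesis
      unfolding expand by (simp add: dist_norm norm_minus_commute)
  qed
  from prox_gap[OF g t(1) g0 this] obtain r where r: "g p = ereal r"
    and gap: "\<And>y a. g y \<le> ereal a \<Longrightarrow> r + ?L / 2 * (norm (p - ?v))\<^sup>2 + ?L / 2 * (norm (p - y))\<^sup>2
      \<le> a + ?L / 2 * (norm (y - ?v))\<^sup>2"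
    unfolding p by blast
  show ?thesis
  proof (rule that[of "f p + r"])
    fix y a assume "ereal (f y) + g y \<le> ereal a"
    then have "g y \<le> ereal (a - f y)" by (cases "g y") auto
    from gap[OF this] descent_lemma[OF grad lip', of p x]
      convex_above_tangent_plane[OF f grad, of x y]
    show "f p + r + ?L / 2 * (dist p y)\<^sup>2 \<le> a + ?L / 2 * (dist x y)\<^sup>2"
      unfolding expand by (simp add: dist_norm norm_minus_commute)
  qed (simp add: r)
qed

section \<open>From the error bound to contraction of the gap and the iteration count\<close>

lemma le_infdist:
  assumes "S \<noteq> {}" "\<And>z. z \<in> S \<Longrightarrow> d \<le> dist x z"
  shows "d \<le> infdist x S"
  using assms by (simp add: infdist_notempty cINF_greatest)

text \<open>Let \<open>e = dist x y\<close>. By the triangle inequality \<open>dist y z\<close> is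
  at least \<open>|dist x z - e|\<close>; inserted in \<open>to_S\<close>, this cancels the squares
  of \<open>dist x z\<close> and leaves a bound linear in \<open>dist x z\<close>. The error bound
  then controls \<open>\<delta>'\<close> by a multiple of \<open>e^2\<close>, and
  \<open>decr\<close> controls \<open>e^2\<close> by a multiple of
  \<open>\<delta> - \<delta>'\<close>.\<close>

lemma error_bound_contraction:
  fixes x y :: "'a::metric_space"
  assumes L: "L > 0" and \<gamma>: "\<gamma> > 0" and S: "S \<noteq> {}" and nonneg: "0 \<le> \<delta>'"
    and to_S: "\<And>z. z \<in> S \<Longrightarrow> \<delta>' + L / 2 * (dist y z)\<^sup>2 \<le> L / 2 * (dist x z)\<^sup>2"
    and decr: "\<delta>' + L / 2 * (dist x y)\<^sup>2 \<le> \<delta>"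
    and stat: "x = y \<Longrightarrow> \<delta>' = \<delta>"
    and eb: "infdist x S \<le> \<gamma> * (L * dist x y)"
  shows "\<delta>' \<le> (1 - 1 / (2 * L * \<gamma>)) * \<delta>"
proof -
  let ?e = "dist x y" and ?c = "2 * L * \<gamma>"
  have key: "\<delta>' + L / 2 * ?e\<^sup>2 \<le> L * ?e * infdist x S"
  proof (cases "?e = 0")
    case True
    then show ?thesis using S to_S by fastforce
  next
    case False
    \<comment> \<open>Division by \<open>L * ?e\<close> leaves a lower bound for
      \<open>dist x z\<close> alone, which passes to the infimum over \<open>S\<close>.\<close>
    have "(\<delta>' + L / 2 * ?e\<^sup>2) / (L * ?e) \<le> infdist x S"
    proof (rule le_infdist[OF S])
      fix z assume z: "z \<in> S"
      have "\<bar>dist x z - ?e\<bar> \<le> dist y z"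
        using dist_triangle[of x z y] dist_triangle[of x y z] by (simp add: dist_commute)
      then have "(dist x z - ?e)\<^sup>2 \<le> (dist y z)\<^sup>2"
        using power_mono[of "\<bar>dist x z - ?e\<bar>" "dist y z" 2] by simp
      then have "L / 2 * (dist x z - ?e)\<^sup>2 \<le> L / 2 * (dist y z)\<^sup>2"
        using L by simp
      with to_S[OF z] have "\<delta>' + L / 2 * ?e\<^sup>2 \<le> dist x z * (L * ?e)"
        by (simp add: power2_eq_square field_simps)
      then show "(\<delta>' + L / 2 * ?e\<^sup>2) / (L * ?e) \<le> dist x z"
        using L False by (simp add: pos_divide_le_eq)
    qed
    then show ?thesis
      using L False by (simp add: pos_divide_le_eq mult.commute)
  qed
  also have "\<dots> \<le> L * ?e * (\<gamma> * (L * ?e))"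
    using eb L by (intro mult_left_mono) auto
  finally have upper: "\<delta>' \<le> (?c - 1) * (L / 2 * ?e\<^sup>2)"
    by (simp add: power2_eq_square algebra_simps)
  have "?c * \<delta>' \<le> (?c - 1) * \<delta>"
  \<comment> \<open>Inserting \<open>decr\<close> in \<open>upper\<close> requires a nonnegative
    factor \<open>?c - 1\<close>. For a negative factor \<open>upper\<close> and
    \<open>nonneg\<close> force \<open>x = y\<close>, and then both gaps vanish by
    \<open>stat\<close>.\<close>
  proof (cases "?c \<ge> 1")
    case True
    then have "(?c - 1) * (L / 2 * ?e\<^sup>2) \<le> (?c - 1) * (\<delta> - \<delta>')"
      using decr by (intro mult_left_mono) auto
    with upper have "\<delta>' \<le> (?c - 1) * (\<delta> - \<delta>')" by (rule order_trans)
    then show ?thesis by (simp add: algebra_simps)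
  next
    case False
    have "?e = 0"
    proof (rule ccontr)
      assume "?e \<noteq> 0"
      then have "(?c - 1) * (L / 2 * ?e\<^sup>2) < 0"
        using False L by (intro mult_neg_pos) auto
      with upper nonneg show False by simp
    qed
    then show ?thesis using upper nonneg stat by simp
  qed
  then show ?thesis
    using L \<gamma> by (simp add: field_simps)
qed

text \<open>The length $j$ of the first phase is an integer and may exceed \<^term>\<open>a\<close>. The excess is absorbed
  by the budget: it even gives $j - 1 + s \le a$ for $s = \delta_j / \nu$, and $s e^{1-s} \le 1$.\<close>
lemma iteration_count:
  fixes \<delta> :: "nat \<Rightarrow> real"
  assumes c: "c > 0" and \<nu>: "\<nu> > 0" and nonneg: "\<And>i. 0 \<le> \<delta> i" and decr: "\<And>i. \<delta> (Suc i) \<le> \<delta> i"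
    and budget: "\<And>n. (\<Sum>i<n. \<delta> (Suc i)) \<le> a * \<nu>"
    and contract: "\<And>i. \<delta> i \<le> \<nu> \<Longrightarrow> \<delta> (Suc i) \<le> (1 - 1 / c) * \<delta> i"
    and \<epsilon>: "\<epsilon> > 0" and k: "a + c * ln (\<delta> 0 / \<epsilon>) \<le> real k"
  shows "\<delta> k \<le> \<epsilon>"
\<comment> \<open>Here monotonicity suffices. The split also sets apart
  \<open>\<delta> 0 = 0\<close>, where the logarithm takes its default value at 0.\<close>
proof (cases "\<delta> 0 \<le> \<epsilon>")
  case True
  then show ?thesis using decseqD[OF decseq_SucI[of \<delta>, OF decr], of 0 k] by simp
next
  case False
  have anti: "\<delta> j \<le> \<delta> i" if "i \<le> j" for i j
    using decseqD[OF decseq_SucI[of \<delta>, OF decr] that] .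
  have sum_lower: "real i * \<nu> \<le> (\<Sum>l<i. \<delta> (Suc l))" if "\<And>l. l \<le> i \<Longrightarrow> \<nu> < \<delta> l" for i
    using sum_mono[of "{..<i}" "\<lambda>_. \<nu>" "\<lambda>l. \<delta> (Suc l)"] that[of "Suc _"] by (auto simp: less_imp_le)
  have "0 < c * ln (\<delta> 0 / \<epsilon>)" using False \<epsilon> c by simp
  then have ak: "a < real k" using k by simp
  \<comment> \<open>Since \<open>k > a\<close>, gaps above \<nu> at all indices up to
    \<open>k\<close> would exceed the budget.\<close>
  have ex: "\<exists>j\<le>k. \<delta> j \<le> \<nu>"
  proof (rule ccontr)
    assume "\<not> ?thesis"
    then have "real k * \<nu> \<le> a * \<nu>"
      using sum_lower[of k] budget[of k] by force
    then show False using ak \<nu> by simp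
  qed
  define j where "j = (LEAST j. \<delta> j \<le> \<nu>)"
  obtain j' where j': "j' \<le> k" "\<delta> j' \<le> \<nu>" using ex by blast
  have j: "\<delta> j \<le> \<nu>" unfolding j_def using j'(2) by (rule LeastI)
  have jk: "j \<le> k" using Least_le[of "\<lambda>j. \<delta> j \<le> \<nu>" j'] j' by (simp add: j_def)
  have before: "\<nu> < \<delta> i" if "i < j" for i
    using not_less_Least[OF that[unfolded j_def]] by simp
  show ?thesis
  proof (cases "\<delta> j = 0")
    case True
    then show ?thesis using anti[OF jk] \<epsilon> by simp
  next
    case False
    then have pos: "\<delta> j > 0" using nonneg[of j] by simp
    \<comment> \<open>A negative factor would make the next gap negative. This forces
      \<open>c \<ge> 1\<close>, used below to compare \<open>(1 - s) / c\<close> with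
      \<open>1 - s\<close>.\<close>
    have "0 \<le> (1 - 1 / c) * \<delta> j" using contract[OF j] nonneg[of "Suc j"] by simp
    then have q: "0 \<le> 1 - 1 / c" using pos by (simp add: zero_le_mult_iff)
    then have c1: "c \<ge> 1" using c by (simp add: field_simps)
    have "\<delta> (j + n) \<le> (1 - 1 / c) ^ n * \<delta> j" for n
    proof (induction n)
      case (Suc n)
      have "\<delta> (j + Suc n) \<le> (1 - 1 / c) * \<delta> (j + n)"
        using contract[of "j + n"] anti[of j "j + n"] j by simp
      also have "\<dots> \<le> (1 - 1 / c) * ((1 - 1 / c) ^ n * \<delta> j)"
        using Suc q by (intro mult_left_mono)
      finally show ?case by (simp add: mult.assoc)
    qed simp
    from this[of "k - j"] have "\<delta> k \<le> (1 - 1 / c) ^ (k - j) * \<delta> j" using jk by simp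
    also have "\<dots> \<le> exp (- (1 / c)) ^ (k - j) * \<delta> j"
      using q pos exp_ge_add_one_self[of "- (1 / c)"] by (intro mult_right_mono power_mono) auto
    also have "exp (- (1 / c)) ^ (k - j) = exp (- (real (k - j) / c))"
      by (simp flip: exp_of_nat_mult)
    finally have \<delta>k: "\<delta> k \<le> exp (- (real (k - j) / c)) * \<delta> j" .
    show ?thesis
    proof (cases j)
      case 0
      have "0 \<le> a" using budget[of 0] \<nu> by (simp add: zero_le_mult_iff)
      then have "ln (\<delta> 0 / \<epsilon>) \<le> real k / c"
        using k c by (simp add: field_simps)
      then have "exp (- (real k / c)) \<le> exp (- ln (\<delta> 0 / \<epsilon>))" by simp
      also have "\<dots> = \<epsilon> / \<delta> 0" using pos 0 \<epsilon> by (simp add: exp_minus)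
      finally have "exp (- (real k / c)) * \<delta> 0 \<le> \<epsilon>" using pos 0 by (simp add: field_simps)
      then show ?thesis using \<delta>k 0 by simp
    next
      case (Suc i)
      define s where "s = \<delta> j / \<nu>"
      have \<delta>0: "\<nu> < \<delta> 0" using before Suc by simp
      \<comment> \<open>The gaps with indices 1 to \<open>j - 1\<close> each exceed \<nu>, and the
        last summand of the budget is \<open>s * \<nu>\<close>. Rounding thus costs at most
        \<open>1 - s\<close> of the steps in the second phase.\<close>
      have "real i * \<nu> \<le> (\<Sum>l<i. \<delta> (Suc l))"
        using before Suc by (intro sum_lower) simp
      with budget[of j] have "real i * \<nu> + s * \<nu> \<le> a * \<nu>"
        using \<nu> by (simp add: Suc s_def)
      then have "real i + s \<le> a" using \<nu> by (simp flip: distrib_right)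
      then have "s - 1 + c * ln (\<delta> 0 / \<epsilon>) \<le> real (k - j)"
        using k jk Suc by (simp add: of_nat_diff)
      then have "(s - 1 + c * ln (\<delta> 0 / \<epsilon>)) / c \<le> real (k - j) / c"
        using c by (intro divide_right_mono) simp_all
      then have "(s - 1) / c + ln (\<delta> 0 / \<epsilon>) \<le> real (k - j) / c"
        using c by (simp add: add_divide_distrib)
      moreover have "(1 - s) / c \<le> 1 - s"
      proof -
        have "s \<le> 1" using j \<nu> by (simp add: s_def)
        then show ?thesis using c1 mult_left_mono[of 1 c "1 - s"] by (simp add: divide_le_eq)
      qed
      ultimately have "- (real (k - j) / c) \<le> (1 - s) - ln (\<delta> 0 / \<epsilon>)"
        by (simp add: diff_divide_distrib)
      then have "exp (- (real (k - j) / c)) \<le> exp ((1 - s) - ln (\<delta> 0 / \<epsilon>))" by simp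
      also have "\<dots> = exp (1 - s) * (\<epsilon> / \<delta> 0)"
        using \<delta>0 \<nu> \<epsilon> by (simp add: exp_diff)
      finally have "\<delta> k \<le> exp (1 - s) * (\<epsilon> / \<delta> 0) * \<delta> j"
        using \<delta>k pos by (meson mult_right_mono less_imp_le order_trans)
      \<comment> \<open>The regrouping exposes the factor \<open>\<nu> / \<delta> 0\<close>, which
        is below 1 because the first phase is nonempty here.\<close>
      also have "\<dots> = (s * exp (1 - s)) * (\<epsilon> * (\<nu> / \<delta> 0))"
        using \<nu> by (simp add: s_def)
      also have "\<dots> \<le> 1 * (\<epsilon> * 1)"
      proof (rule mult_mono)
        have "s \<le> exp (s - 1)" using exp_ge_add_one_self[of "s - 1"] by simp
        then have "s * exp (1 - s) \<le> exp (s - 1) * exp (1 - s)" by simp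
        also have "\<dots> = 1" by (simp flip: exp_add)
        finally show "s * exp (1 - s) \<le> 1" .
      qed (use \<delta>0 \<nu> \<epsilon> pos in \<open>auto simp: s_def divide_le_eq\<close>)
      finally show ?thesis by simp
    qed
  qed
qed

section \<open>Geometric convergence to a limit point\<close>

text \<open>\<open>decr\<close> bounds the squared step by a multiple of the gap, so with
  \<open>r = sqrt q\<close> the steps are at most \<open>B r^i\<close>. The geometric tail bounds
  \<open>dist (x k) (x n)\<close> for all \<open>n \<ge> k\<close>; this passes to the limit along
  the subsequence, and squaring yields the constant.\<close>

lemma linear_rate_to_limit_point:
  fixes x :: "nat \<Rightarrow> 'a::metric_space"
  assumes L: "L > 0" and q1: "q < 1" and nonneg: "\<And>k. 0 \<le> \<delta> k"
    and decr: "\<And>k. \<delta> (Suc k) + L / 2 * (dist (x k) (x (Suc k)))\<^sup>2 \<le> \<delta> k"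
    and contract: "\<And>k. \<delta> (Suc k) \<le> q * \<delta> k"
    and lim: "seq_limit_point x z"
  shows "(dist (x k) z)\<^sup>2 \<le> q ^ k * (2 / (L * (1 - sqrt q)\<^sup>2)) * \<delta> 0"
proof -
  obtain \<rho> where \<rho>: "strict_mono \<rho>" and \<rho>_lim: "(\<lambda>n. x (\<rho> n)) \<longlonglongrightarrow> z"
    using lim by (auto simp: seq_limit_point_def o_def)
  have step: "(dist (x i) (x (Suc i)))\<^sup>2 \<le> 2 / L * \<delta> i" for i
    using decr[of i] nonneg[of "Suc i"] L by (simp add: field_simps)
  show ?thesis
  \<comment> \<open>In the application this means \<open>2 L \<gamma> < 1\<close>. Contraction of
    nonnegative gaps then forces them all to 0, so the sequence is constant and both sides are
    0.\<close>
  proof (cases "q < 0")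
    case True
    have zero: "\<delta> i = 0" for i
    proof (rule ccontr)
      assume "\<delta> i \<noteq> 0"
      then have "q * \<delta> i < 0" using True nonneg[of i] by (intro mult_neg_pos) auto
      then show False using contract[of i] nonneg[of "Suc i"] by simp
    qed
    then have "x (Suc i) = x i" for i using step[of i] by simp
    then have const: "x i = x 0" for i by (induction i) auto
    then have "(\<lambda>n. x (\<rho> n)) = (\<lambda>n. x 0)" by blast
    then have "z = x 0" using \<rho>_lim by (simp add: LIMSEQ_const_iff)
    then show ?thesis using zero const[of k] by simp
  next
    case False
    define r where "r = sqrt q"
    have r: "0 \<le> r" "r < 1" "r\<^sup>2 = q" using False q1 by (auto simp: r_def)
    define B where "B = sqrt (2 / L * \<delta> 0)"
    have B: "0 \<le> B" "B\<^sup>2 = 2 / L * \<delta> 0" using L nonneg[of 0] by (auto simp: B_def)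
    have \<delta>_le: "\<delta> i \<le> q ^ i * \<delta> 0" for i
    proof (induction i)
      case (Suc i)
      have "\<delta> (Suc i) \<le> q * (q ^ i * \<delta> 0)"
        using contract[of i] mult_left_mono[OF Suc, of q] False by linarith
      then show ?case by (simp add: mult.assoc)
    qed simp
    have dist_step: "dist (x i) (x (Suc i)) \<le> B * r ^ i" for i
    proof (rule power2_le_imp_le)
      have "(dist (x i) (x (Suc i)))\<^sup>2 \<le> 2 / L * (q ^ i * \<delta> 0)"
        using mult_left_mono[OF \<delta>_le[of i], of "2 / L"] L by (intro order_trans[OF step]) simp
      also have "\<dots> = (B * r ^ i)\<^sup>2"
        using B r by (simp add: power_mult_distrib power_commutes flip: power_mult power_mult[of r 2] r(3))
          (simp add: mult.commute power_mult)
      finally show "(dist (x i) (x (Suc i)))\<^sup>2 \<le> (B * r ^ i)\<^sup>2" .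
    qed (use B r in simp)
    \<comment> \<open>With the factor \<open>1 - r\<close> on the left, the geometric partial sum
      becomes \<open>1 - r ^ n\<close> and the induction telescopes.\<close>
    have dist_le: "(1 - r) * dist (x k) (x (k + n)) \<le> B * r ^ k * (1 - r ^ n)" for n
    proof (induction n)
      case (Suc n)
      have "(1 - r) * dist (x k) (x (k + Suc n))
          \<le> (1 - r) * (dist (x k) (x (k + n)) + dist (x (k + n)) (x (k + Suc n)))"
        using r by (intro mult_left_mono dist_triangle) auto
      also have "\<dots> \<le> B * r ^ k * (1 - r ^ n) + (1 - r) * (B * r ^ (k + n))"
        unfolding distrib_left using Suc r dist_step[of "k + n"]
        by (intro add_mono mult_left_mono) auto
      also have "\<dots> = B * r ^ k * (1 - r ^ Suc n)" by (simp add: power_add algebra_simps)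
      finally show ?case .
    qed simp
    have far: "dist (x k) (x n) \<le> B * r ^ k / (1 - r)" if "n \<ge> k" for n
    proof -
      have "(1 - r) * dist (x k) (x n) \<le> B * r ^ k * (1 - r ^ (n - k))"
        using dist_le[of "n - k"] that by simp
      also have "\<dots> \<le> B * r ^ k * 1" using B r by (intro mult_left_mono) auto
      finally show ?thesis using r by (simp add: pos_le_divide_eq mult.commute)
    qed
    have "(\<lambda>n. dist (x k) (x (\<rho> n))) \<longlonglongrightarrow> dist (x k) z"
      by (intro tendsto_intros \<rho>_lim)
    moreover have "\<forall>n\<ge>k. dist (x k) (x (\<rho> n)) \<le> B * r ^ k / (1 - r)"
      using far seq_suble[OF \<rho>] order_trans by blast
    ultimately have "dist (x k) z \<le> B * r ^ k / (1 - r)"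
      by (intro Lim_bounded)
    then have "(dist (x k) z)\<^sup>2 \<le> (B * r ^ k / (1 - r))\<^sup>2" by (intro power_mono) auto
    also have "\<dots> = q ^ k * (2 / (L * (1 - sqrt q)\<^sup>2)) * \<delta> 0"
      using B(2) r(3)
      by (simp add: power_divide power_mult_distrib r_def flip: power_mult) (simp add: power_mult mult.commute[of k])
    finally show ?thesis .
  qed
qed

lemma seq_limit_point_shift:
  assumes "seq_limit_point x z"
  shows "seq_limit_point (\<lambda>k. x (r + k)) z"
proof -
  obtain \<rho> where \<rho>: "strict_mono \<rho>" "(\<lambda>n. x (\<rho> n)) \<longlonglongrightarrow> z"
    using assms by (auto simp: seq_limit_point_def o_def)
  \<comment> \<open>Starting the subsequence at index \<open>r\<close> keeps the subtraction of
    natural numbers below from truncating.\<close>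
  have ge: "r \<le> \<rho> (n + r)" for n
    using seq_suble[OF \<rho>(1), of "n + r"] by simp
  have "strict_mono (\<lambda>n. \<rho> (n + r) - r)"
    using \<rho>(1) ge by (auto simp: strict_mono_def intro!: diff_less_mono)
  moreover have "(\<lambda>n. x (r + (\<rho> (n + r) - r))) \<longlonglongrightarrow> z"
    using LIMSEQ_ignore_initial_segment[OF \<rho>(2), of r] ge by simp
  ultimately show ?thesis
    by (auto simp: seq_limit_point_def o_def)
qed

section \<open>Assembly: the gaps along the iterates and the two rates\<close>

theorem theorem3p2:
  fixes f :: "real ^ 'n \<Rightarrow> real" and gradf :: "real ^ 'n \<Rightarrow> real ^ 'n"
    and g :: "real ^ 'n \<Rightarrow> ereal" and \<phi> :: "real ^ 'n \<Rightarrow> ereal"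
    and x :: "nat \<Rightarrow> real ^ 'n"
    and S :: "(real ^ 'n) set"
    and \<beta> t \<gamma> \<nu> \<phi>min L :: real
  assumes g: "closed_convex_fun g"
    and f_convex: "convex_on UNIV f"
    and f_grad: "\<forall>y. GDERIV f y :> gradf y"
    and f_lipschitz: "\<beta>-lipschitz_on UNIV gradf"
    and \<beta>_pos: "\<beta> > 0"
    and \<phi>_eq: "\<phi> = (\<lambda>y. ereal (f y) + g y)"
    and S_eq: "S = minimizers \<phi>"
    and \<phi>min: "is_minimal_value \<phi> \<phi>min"
    and \<gamma>_pos: "\<gamma> > 0" and \<nu>_pos: "\<nu> > 0"
    and eb: "error_bound t f gradf g \<phi>min \<gamma> \<nu>"
    and t_pos: "t > 0" and t_le: "t \<le> 1 / \<beta>"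
    and L_eq: "L = 1 / t"
    and iterates: "prox_grad_iterates t g gradf x"
  shows "(\<phi> (x 0) < \<infinity> \<longrightarrow>
           (\<forall>\<epsilon>>0. \<forall>k. iteration_bound L \<gamma> \<nu> (infdist (x 0) S) (real_of_ereal (\<phi> (x 0)) - \<phi>min) \<epsilon> \<le> real k
              \<longrightarrow> \<phi> (x k) - ereal \<phi>min \<le> ereal \<epsilon>))
       \<and> (\<forall>xlim. seq_limit_point x xlim \<longrightarrow>
           (\<exists>r. \<phi> (x r) < \<infinity> \<and>
              (\<forall>k\<ge>1. (norm (x (r + k) - xlim))\<^sup>2
                 \<le> (1 - 1 / (2 * L * \<gamma>)) ^ k * limit_constant L \<gamma> * (real_of_ereal (\<phi> (x r)) - \<phi>min))))"
proof -
  \<comment> \<open>\<open>real_of_ereal\<close> sends an infinite value to 0, so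
    \<open>\<delta> k\<close> is the true gap only where \<open>\<phi> (x k)\<close> is finite. Only
    index 0 can fail this, since every step lands at a finite value.\<close>
  define \<delta> where "\<delta> k = real_of_ereal (\<phi> (x k)) - \<phi>min" for k
  define c where "c = 2 * L * \<gamma>"
  have L: "L > 0" using t_pos L_eq by simp
  have c: "c > 0" using L \<gamma>_pos by (simp add: c_def)
  have lower: "ereal \<phi>min \<le> \<phi> y" for y
    using \<phi>min by (auto simp: is_minimal_value_def)
  obtain z0 where z0: "\<phi> z0 = ereal \<phi>min"
    using \<phi>min by (auto simp: is_minimal_value_def)
  have S_val: "\<phi> z = ereal \<phi>min" if "z \<in> S" for z
    using that lower[of z] z0 by (metis (mono_tags) S_eq minimizers_def mem_Collect_eq antisym)
  have S_ne: "S \<noteq> {}"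
    using z0 lower by (auto simp: S_eq minimizers_def intro!: exI[of _ z0])
  have step: "\<exists>s. \<phi> (x (Suc k)) = ereal s \<and> (\<forall>y a. \<phi> y \<le> ereal a \<longrightarrow>
      s + L / 2 * (dist (x (Suc k)) y)\<^sup>2 \<le> a + L / 2 * (dist (x k) y)\<^sup>2)" for k
  proof -
    have g0: "g z0 < \<infinity>" using z0 by (cases "g z0") (auto simp: \<phi>_eq)
    have "\<beta> \<le> 1 / t" using t_le t_pos \<beta>_pos by (simp add: field_simps)
    moreover have "x (Suc k) = prox t g (x k - t *\<^sub>R gradf (x k))"
      using iterates by (simp add: prox_grad_iterates_def)
    ultimately obtain s where "ereal (f (x (Suc k))) + g (x (Suc k)) = ereal s"
      and "\<And>y a. ereal (f y) + g y \<le> ereal a \<Longrightarrow>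
        s + 1 / t / 2 * (dist (x (Suc k)) y)\<^sup>2 \<le> a + 1 / t / 2 * (dist (x k) y)\<^sup>2"
      using prox_grad_step[OF g f_convex f_grad[rule_format] f_lipschitz t_pos _ lower[unfolded \<phi>_eq] g0]
      by metis
    then show ?thesis unfolding \<phi>_eq L_eq by blast
  qed
  have val: "\<phi> (x k) = ereal (\<phi>min + \<delta> k)" if "\<phi> (x k) < \<infinity>" for k
    using that lower[of "x k"] by (cases "\<phi> (x k)") (auto simp: \<delta>_def)
  have fin: "\<phi> (x (Suc k)) < \<infinity>" for k
    using step[of k] by auto
  have ineq: "\<phi>min + \<delta> (Suc k) + L / 2 * (dist (x (Suc k)) y)\<^sup>2 \<le> a + L / 2 * (dist (x k) y)\<^sup>2"
    if "\<phi> y \<le> ereal a" for k y a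
    using step[of k] val[OF fin, of k] that by auto
  have nonneg: "0 \<le> \<delta> k" if "\<phi> (x k) < \<infinity>" for k
    using lower[of "x k"] val[OF that] by simp
  have to_S: "\<delta> (Suc k) + L / 2 * (dist (x (Suc k)) z)\<^sup>2 \<le> L / 2 * (dist (x k) z)\<^sup>2"
    if "z \<in> S" for k z
    using ineq[of z \<phi>min k] S_val[OF that] by simp
  have decr: "\<delta> (Suc k) + L / 2 * (dist (x k) (x (Suc k)))\<^sup>2 \<le> \<delta> k" if "\<phi> (x k) < \<infinity>" for k
    using ineq[of "x k" "\<phi>min + \<delta> k" k] val[OF that] by (simp add: dist_commute)
  have decr': "\<delta> (Suc k) \<le> \<delta> k" if "\<phi> (x k) < \<infinity>" for k
    using decr[OF that] L by (smt (verit) mult_nonneg_nonneg divide_nonneg_nonneg zero_le_power2)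
  have contract: "\<delta> (Suc k) \<le> (1 - 1 / c) * \<delta> k" if k: "\<phi> (x k) < \<infinity>" "\<delta> k \<le> \<nu>" for k
    unfolding c_def
  proof (rule error_bound_contraction[OF L \<gamma>_pos S_ne nonneg[OF fin] to_S decr[OF k(1)]])
    have "prox_grad_map t g gradf (x k) = L *\<^sub>R (x k - x (Suc k))"
      using iterates by (simp add: prox_grad_map_def prox_grad_iterates_def L_eq)
    then have "norm (prox_grad_map t g gradf (x k)) = L * dist (x k) (x (Suc k))"
      using L by (simp add: dist_norm)
    moreover have "ereal (f (x k)) + g (x k) \<le> ereal (\<phi>min + \<nu>)"
      using val[OF k(1)] k(2) by (simp add: \<phi>_eq)
    ultimately show "infdist (x k) S \<le> \<gamma> * (L * dist (x k) (x (Suc k)))"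
      using eb unfolding error_bound_def S_eq \<phi>_eq by metis
  next
    assume "x k = x (Suc k)"
    then show "\<delta> (Suc k) = \<delta> k" by (metis \<delta>_def)
  qed
  have budget: "(\<Sum>i<n. \<delta> (Suc i)) \<le> L / 2 * (infdist (x 0) S)\<^sup>2" for n
  proof -
    let ?s = "\<Sum>i<n. \<delta> (Suc i)"
    \<comment> \<open>Solved for the distance, the telescoped bound for each minimizer passes to the
      infimum.\<close>
    have "sqrt (2 / L * ?s) \<le> infdist (x 0) S"
    proof (rule le_infdist[OF S_ne])
      fix z assume z: "z \<in> S"
      have "?s + L / 2 * (dist (x n) z)\<^sup>2 \<le> L / 2 * (dist (x 0) z)\<^sup>2"
      proof (induction n)
        case (Suc n)
        then show ?case using to_S[OF z, of n] by simp
      qed simp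
      moreover have "0 \<le> L / 2 * (dist (x n) z)\<^sup>2" using L by simp
      ultimately have "?s \<le> L / 2 * (dist (x 0) z)\<^sup>2" by linarith
      then have "2 / L * ?s \<le> (dist (x 0) z)\<^sup>2" using L by (simp add: field_simps)
      then show "sqrt (2 / L * ?s) \<le> dist (x 0) z" by (simp add: real_le_lsqrt)
    qed
    then have "2 / L * ?s \<le> (infdist (x 0) S)\<^sup>2" by (rule sqrt_le_D)
    then show ?thesis using L by (simp add: field_simps)
  qed
  show ?thesis
  proof (intro conjI allI impI)
    fix \<epsilon> :: real and k
    assume fin0: "\<phi> (x 0) < \<infinity>" and \<epsilon>: "\<epsilon> > 0"
      and k: "iteration_bound L \<gamma> \<nu> (infdist (x 0) S) (real_of_ereal (\<phi> (x 0)) - \<phi>min) \<epsilon> \<le> real k"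
    have fin_all: "\<phi> (x i) < \<infinity>" for i using fin0 fin by (cases i) auto
    have "\<delta> k \<le> \<epsilon>"
    proof (rule iteration_count[where \<delta> = \<delta>, OF c \<nu>_pos nonneg[OF fin_all] decr'[OF fin_all] _ contract[OF fin_all] \<epsilon>])
      \<comment> \<open>Measured in multiples of \<nu>, the budget is the first term of
        \<open>iteration_bound\<close>.\<close>
      show "(\<Sum>i<n. \<delta> (Suc i)) \<le> L / (2 * \<nu>) * (infdist (x 0) S)\<^sup>2 * \<nu>" for n
        using budget[of n] \<nu>_pos by simp
      show "L / (2 * \<nu>) * (infdist (x 0) S)\<^sup>2 + c * ln (\<delta> 0 / \<epsilon>) \<le> real k"
        using k by (simp add: iteration_bound_def \<delta>_def c_def)
    qed
    then show "\<phi> (x k) - ereal \<phi>min \<le> ereal \<epsilon>" by (simp add: val[OF fin_all])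
  next
    fix xlim assume lim: "seq_limit_point x xlim"
    \<comment> \<open>Gaps that stay above \<nu> would exhaust the budget. Successor indices are
      used because \<open>\<phi> (x 0)\<close> may be infinite here.\<close>
    have "\<exists>r. \<delta> (Suc r) \<le> \<nu>"
    proof (rule ccontr)
      assume "\<not> ?thesis"
      then have "(\<Sum>i<n. \<nu>) \<le> (\<Sum>i<n. \<delta> (Suc i))" for n
        by (intro sum_mono) (simp add: not_le less_imp_le)
      then have "real n * \<nu> \<le> L / 2 * (infdist (x 0) S)\<^sup>2" for n
        using order_trans[OF _ budget[of n]] by simp
      then show False
        using reals_Archimedean3[OF \<nu>_pos, rule_format, of "L / 2 * (infdist (x 0) S)\<^sup>2"]
        by (meson not_le)
    qed
    then obtain r0 where r0: "\<delta> (Suc r0) \<le> \<nu>" by blast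
    define r where "r = Suc r0"
    have fin_r: "\<phi> (x (r + k)) < \<infinity>" for k using fin by (simp add: r_def)
    have "\<delta> (r + k) \<le> \<nu>" for k
    proof (induction k)
      case (Suc k)
      then show ?case using decr'[OF fin_r, of k] by simp
    qed (simp add: r0 r_def)
    then have contr: "\<delta> (r + Suc k) \<le> (1 - 1 / c) * \<delta> (r + k)" for k
      using contract[OF fin_r] by simp
    have "seq_limit_point (\<lambda>k. x (r + k)) xlim"
      by (rule seq_limit_point_shift[OF lim])
    from linear_rate_to_limit_point[where \<delta> = "\<lambda>k. \<delta> (r + k)" and L = L, OF L _ nonneg[OF fin_r] _ contr this]
    have "(dist (x (r + k)) xlim)\<^sup>2 \<le> (1 - 1 / c) ^ k * (2 / (L * (1 - sqrt (1 - 1 / c))\<^sup>2)) * \<delta> r" for k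
      using c decr[OF fin_r] by simp
    then have "\<forall>k\<ge>1. (norm (x (r + k) - xlim))\<^sup>2
        \<le> (1 - 1 / (2 * L * \<gamma>)) ^ k * limit_constant L \<gamma> * (real_of_ereal (\<phi> (x r)) - \<phi>min)"
      by (simp add: limit_constant_def c_def \<delta>_def dist_norm)
    then show "\<exists>r. \<phi> (x r) < \<infinity> \<and> (\<forall>k\<ge>1. (norm (x (r + k) - xlim))\<^sup>2
        \<le> (1 - 1 / (2 * L * \<gamma>)) ^ k * limit_constant L \<gamma> * (real_of_ereal (\<phi> (x r)) - \<phi>min))"
      using fin_r[of 0] by auto
  qed
qed

end
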